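(* Let $A$ be a residuated lattice and let $\mathcal{L}(A)$ be (the bounded distributive lattice of) its reticulation. The following are equivalent: (1) the bounded distributive lattice $\mathrm{Filt}(A)$ is normal; (2) the bounded distributive lattice $\mathrm{PFilt}(A)$ is normal, that is: for all $x,y\in A$, if $[x)\vee[y)=A$, then there exist $u,v\in A$ such that $[u)\cap[v)=\{1\}$ and $[u)\vee[x)=[v)\vee[y)=A$; (3) the bounded distributive lattice $\mathcal{L}(A)$ is conormal; (4) any prime filter of $A$ is included in a unique maximal filter of $A$; (5) any prime filter of $\mathcal{L}(A)$ is included in a unique maximal filter of $\mathcal{L}(A)$; (6) the inclusion $\mathrm{Max}(A)\subseteq\mathrm{Spec}(A)$ admits a continuous retract; (7) the inclusion $\mathrm{Max}(\mathcal{L}(A))\subseteq\mathrm{Spec}(\mathcal{L}(A))$ admits a continuous retract; (8) $\mathrm{Spec}(A)$ is a normal topological space; (9) $\mathrm{Spec}(\mathcal{L}(A))$ is a normal topological space; (10) for any $M\in\mathrm{Max}(A)$, $\{P\in\mathrm{Spec}(A)\mid P\subseteq M\}$ is a closed subset of $\mathrm{Spec}(A)$; (11) for any $M\in\mathrm{Max}(\mathcal{L}(A))$, $\{P\in\mathrm{Spec}(\mathcal{L}(A))\mid P\subseteq M\}$ is a closed subset of $\mathrm{Spec}(\mathcal{L}(A))$; (12) for any $M\in\mathrm{Max}(A)$, $M$ is the only maximal filter of $A$ which includes $\bigcap\{P\in\mathrm{Spec}(A)\mid P\subseteq M\}$; (13) for any $M\in\mathrm{Max}(\mathcal{L}(A))$,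 $M$ is the only maximal filter of $\mathcal{L}(A)$ which includes $\bigcap\{P\in\mathrm{Spec}(\mathcal{L}(A))\mid P\subseteq M\}$; (14) any two distinct maximal filters of $A$ can be separated by disjoint open sets in $\mathrm{Spec}(A)$; (15) any two distinct maximal filters of $\mathcal{L}(A)$ can be separated by disjoint open sets in $\mathrm{Spec}(\mathcal{L}(A))$.
   Context: A residuated lattice is an algebra $(A,\vee,\wedge,\odot,\rightarrow,0,1)$ such that $(A,\vee,\wedge,0,1)$ is a bounded lattice (with order $\leq$), $(A,\odot,1)$ is a commutative monoid, and $a\leq b\rightarrow c$ iff $a\odot b\leq c$ for all $a,b,c$. $a^n$ denotes the $n$-fold $\odot$-power and $\mathbb{N}^*$ the nonzero naturals. A filter of $A$ is a non-empty subset closed under $\odot$ and upward closed; it is proper if it is not $A$. $[x)=\{a\in A\mid x^n\leq a\text{ for some }n\in\mathbb{N}^*\}$ is the principal filter generated by $x$; $F\vee G$ is the filter generated by $F\cup G$. $(\mathrm{Filt}(A),\vee,\cap,\{1\},A)$ is the bounded distributive lattice of filters, ordered by inclusion (bottom $\{1\}$, top $A$), and $\mathrm{PFilt}(A)$ is its bounded sublattice of principal filters. For a bounded distributive lattice, filters are defined in the same way with $\wedge$ in place of $\odot$. In both cases, a prime filter is a proper filter $P$ such that $a\vee b\in P$ implies $a\in P$ or $b\in P$; a maximal filter is a maximal proper filter (maximal filters are prime). $\mathrm{Spec}(\cdot)$ and $\mathrm{Max}(\cdot)$ are the sets of prime and maximal filters. $\mathrm{Spec}(\cdot)$ has the Stone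 topology, with open sets $D(F)=\{P\in\mathrm{Spec}(\cdot)\mid F\nsubseteq P\}$, $F$ a filter, and $\mathrm{Max}(\cdot)$ has the subspace topology. A continuous retract of $\mathrm{Max}\subseteq\mathrm{Spec}$ is a continuous map $\rho:\mathrm{Spec}\to\mathrm{Max}$ with $\rho(M)=M$ for all $M\in\mathrm{Max}$. The reticulation of $A$ is a pair $(\mathcal{L}(A),\lambda)$, unique up to bounded lattice isomorphism (compatible with $\lambda$), where $\mathcal{L}(A)$ is a bounded distributive lattice and $\lambda:A\to\mathcal{L}(A)$ is a surjection with $\lambda(a\odot b)=\lambda(a)\wedge\lambda(b)$, $\lambda(a\vee b)=\lambda(a)\vee\lambda(b)$, $\lambda(0)=0$, $\lambda(1)=1$, and $\lambda(a)\leq\lambda(b)$ iff $a^n\leq b$ for some $n\in\mathbb{N}^*$. A bounded distributive lattice $L$ is normal iff for all $x,y\in L$ with $x\vee y=1$ there are $u,v\in L$ with $u\wedge v=0$ and $u\vee x=v\vee y=1$; it is conormal iff for all $x,y\in L$ with $x\wedge y=0$ there are $u,v\in L$ with $u\vee v=1$ and $u\wedge x=v\wedge y=0$. A topological space is normal iff any two disjoint closed sets are contained in disjoint open sets (no separation axiom is assumed). *)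

theory Defs
  imports "HOL-Analysis.Abstract_Topological_Spaces"
begin

text \<open>The product \<open>*\<close> plays the role of \<open>\<odot>\<close>, so that \<open>a ^ n\<close> is the \<open>n\<close>-fold \<open>\<odot>\<close>-power; the
  bounds 0 and 1 of the lattice are \<open>bot\<close> and \<open>top = 1\<close>. The one-element algebra is allowed.\<close>

class residuated_lattice = bounded_lattice + comm_monoid_mult +
  fixes residuum :: "'a \<Rightarrow> 'a \<Rightarrow> 'a"
  assumes one_eq_top: "1 = top"
    and residuation: "a \<le> residuum b c \<longleftrightarrow> a * b \<le> c"

class bounded_distrib_lattice = bounded_lattice + distrib_lattice

text \<open>Normality and conormality are stated for a lattice given by its carrier, join, meet, bottom and
  top, since the lattices of filters below are carried by a set of sets.\<close>

definition normal_lattice ::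
    "'a set \<Rightarrow> ('a \<Rightarrow> 'a \<Rightarrow> 'a) \<Rightarrow> ('a \<Rightarrow> 'a \<Rightarrow> 'a) \<Rightarrow> 'a \<Rightarrow> 'a \<Rightarrow> bool" where
  "normal_lattice C join meet b t \<longleftrightarrow>
     (\<forall>x\<in>C. \<forall>y\<in>C. join x y = t \<longrightarrow>
        (\<exists>u\<in>C. \<exists>v\<in>C. meet u v = b \<and> join u x = t \<and> join v y = t))"

definition conormal_lattice ::
    "'a set \<Rightarrow> ('a \<Rightarrow> 'a \<Rightarrow> 'a) \<Rightarrow> ('a \<Rightarrow> 'a \<Rightarrow> 'a) \<Rightarrow> 'a \<Rightarrow> 'a \<Rightarrow> bool" where
  "conormal_lattice C join meet b t \<longleftrightarrow>
     (\<forall>x\<in>C. \<forall>y\<in>C. meet x y = b \<longrightarrow>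
        (\<exists>u\<in>C. \<exists>v\<in>C. join u v = t \<and> meet u x = b \<and> meet v y = b))"

text \<open>The parameter \<open>m\<close> is the operation under which filters are closed: \<open>(*)\<close> for a residuated
  lattice and \<open>inf\<close> for a bounded distributive lattice.\<close>

definition lat_filter :: "('a::bounded_lattice \<Rightarrow> 'a \<Rightarrow> 'a) \<Rightarrow> 'a set \<Rightarrow> bool" where
  "lat_filter m F \<longleftrightarrow>
     F \<noteq> {} \<and> (\<forall>a\<in>F. \<forall>b\<in>F. m a b \<in> F) \<and> (\<forall>a\<in>F. \<forall>b. a \<le> b \<longrightarrow> b \<in> F)"

definition proper_filter :: "('a::bounded_lattice \<Rightarrow> 'a \<Rightarrow> 'a) \<Rightarrow> 'a set \<Rightarrow> bool" where
  "proper_filter m F \<longleftrightarrow> lat_filter m F \<and> F \<noteq> UNIV"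

definition Spec_filt :: "('a::bounded_lattice \<Rightarrow> 'a \<Rightarrow> 'a) \<Rightarrow> 'a set set" where
  "Spec_filt m = {P. proper_filter m P \<and> (\<forall>a b. sup a b \<in> P \<longrightarrow> a \<in> P \<or> b \<in> P)}"

definition Max_filt :: "('a::bounded_lattice \<Rightarrow> 'a \<Rightarrow> 'a) \<Rightarrow> 'a set set" where
  "Max_filt m = {M. proper_filter m M \<and> (\<forall>F. proper_filter m F \<and> M \<subseteq> F \<longrightarrow> F = M)}"

definition filter_gen :: "('a::bounded_lattice \<Rightarrow> 'a \<Rightarrow> 'a) \<Rightarrow> 'a set \<Rightarrow> 'a set" where
  "filter_gen m X = \<Inter>{F. lat_filter m F \<and> X \<subseteq> F}"

definition filter_join :: "('a::bounded_lattice \<Rightarrow> 'a \<Rightarrow> 'a) \<Rightarrow> 'a set \<Rightarrow> 'a set \<Rightarrow> 'a set" where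
  "filter_join m F G = filter_gen m (F \<union> G)"

definition principal_filt :: "'a::residuated_lattice \<Rightarrow> 'a set" where
  "principal_filt x = {a. \<exists>n\<ge>1. x ^ n \<le> a}"

definition normal_Filt :: "'a::residuated_lattice itself \<Rightarrow> bool" where
  "normal_Filt _ \<longleftrightarrow>
     normal_lattice {F :: 'a set. lat_filter (*) F} (filter_join (*)) (\<inter>) {1} UNIV"

definition normal_PFilt :: "'a::residuated_lattice itself \<Rightarrow> bool" where
  "normal_PFilt _ \<longleftrightarrow>
     normal_lattice (range (principal_filt :: 'a \<Rightarrow> 'a set)) (filter_join (*)) (\<inter>) {1} UNIV"

lemma normal_PFilt_iff:
  "normal_PFilt TYPE('a::residuated_lattice) \<longleftrightarrow>
     (\<forall>x y :: 'a. filter_join (*) (principal_filt x) (principal_filt y) = UNIV \<longrightarrow>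
        (\<exists>u v :: 'a. principal_filt u \<inter> principal_filt v = {1} \<and>
           filter_join (*) (principal_filt u) (principal_filt x) = UNIV \<and>
           filter_join (*) (principal_filt v) (principal_filt y) = UNIV))"
  by (simp add: normal_PFilt_def normal_lattice_def)

definition spec_open :: "('a::bounded_lattice \<Rightarrow> 'a \<Rightarrow> 'a) \<Rightarrow> 'a set \<Rightarrow> 'a set set" where
  "spec_open m F = {P \<in> Spec_filt m. \<not> F \<subseteq> P}"

definition spec_top :: "('a::bounded_lattice \<Rightarrow> 'a \<Rightarrow> 'a) \<Rightarrow> 'a set topology" where
  "spec_top m = topology (\<lambda>U. \<exists>F. lat_filter m F \<and> U = spec_open m F)"

lemma lat_filter_top: "lat_filter m F \<Longrightarrow> top \<in> F"
  unfolding lat_filter_def by (metis all_not_in_conv top_greatest)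

lemma lat_filter_Inter:
  assumes "\<And>F. F \<in> \<F> \<Longrightarrow> lat_filter m F"
  shows "lat_filter m (\<Inter>\<F>)"
proof -
  have "top \<in> \<Inter>\<F>"
    using assms lat_filter_top by blast
  moreover have "m a b \<in> \<Inter>\<F>" if "a \<in> \<Inter>\<F>" "b \<in> \<Inter>\<F>" for a b
    using assms that unfolding lat_filter_def by blast
  moreover have "b \<in> \<Inter>\<F>" if "a \<in> \<Inter>\<F>" "a \<le> b" for a b
    using assms that unfolding lat_filter_def by blast
  ultimately show ?thesis
    unfolding lat_filter_def by blast
qed

lemma lat_filter_gen: "lat_filter m (filter_gen m X)"
  unfolding filter_gen_def by (rule lat_filter_Inter) simp

lemma lat_filter_UNIV: "lat_filter m UNIV"
  by (simp add: lat_filter_def)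

lemma spec_open_Int:
  assumes "lat_filter m F" "lat_filter m G"
  shows "spec_open m F \<inter> spec_open m G = spec_open m (F \<inter> G)"
proof (intro equalityI subsetI)
  fix P assume "P \<in> spec_open m F \<inter> spec_open m G"
  then obtain a b where P: "P \<in> Spec_filt m" and ab: "a \<in> F" "a \<notin> P" "b \<in> G" "b \<notin> P"
    by (auto simp: spec_open_def)
  have "sup a b \<in> F \<inter> G"
    using assms ab unfolding lat_filter_def by (meson IntI sup_ge1 sup_ge2)
  moreover have "sup a b \<notin> P"
    using P ab by (auto simp: Spec_filt_def)
  ultimately show "P \<in> spec_open m (F \<inter> G)"
    using P by (auto simp: spec_open_def)
qed (auto simp: spec_open_def)

lemma spec_open_Union:
  assumes "\<And>F. F \<in> \<F> \<Longrightarrow> lat_filter m F"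
  shows "\<Union>(spec_open m ` \<F>) = spec_open m (filter_gen m (\<Union>\<F>))"
proof -
  have "filter_gen m (\<Union>\<F>) \<subseteq> P \<longleftrightarrow> (\<forall>F\<in>\<F>. F \<subseteq> P)" if "P \<in> Spec_filt m" for P
  proof -
    have "lat_filter m P"
      using that by (simp add: Spec_filt_def proper_filter_def)
    then have "filter_gen m (\<Union>\<F>) \<subseteq> P" if "\<Union>\<F> \<subseteq> P"
      unfolding filter_gen_def using that by (intro Inter_lower) simp
    moreover have "\<Union>\<F> \<subseteq> filter_gen m (\<Union>\<F>)"
      unfolding filter_gen_def by (intro Inter_greatest) simp
    ultimately show ?thesis
      by (meson Sup_le_iff subset_trans)
  qed
  then show ?thesis
    by (auto simp: spec_open_def)
qed

lemma openin_spec_top: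
  "openin (spec_top m) U \<longleftrightarrow> (\<exists>F. lat_filter m F \<and> U = spec_open m F)"
proof -
  have "istopology (\<lambda>U. \<exists>F. lat_filter m F \<and> U = spec_open m F)"
    unfolding istopology_def
  proof (intro conjI allI impI)
    fix S T assume "\<exists>F. lat_filter m F \<and> S = spec_open m F" "\<exists>F. lat_filter m F \<and> T = spec_open m F"
    then obtain F G where "lat_filter m F" "S = spec_open m F" "lat_filter m G" "T = spec_open m G"
      by blast
    moreover from this have "lat_filter m (F \<inter> G)"
      using lat_filter_Inter[of "{F, G}" m] by auto
    ultimately show "\<exists>H. lat_filter m H \<and> S \<inter> T = spec_open m H"
      using spec_open_Int by blast
  next
    fix \<K> assume K: "\<forall>U\<in>\<K>. \<exists>F. lat_filter m F \<and> U = spec_open m F"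
    define \<F> where "\<F> = {F. lat_filter m F \<and> spec_open m F \<in> \<K>}"
    have "\<K> = spec_open m ` \<F>"
    proof (intro equalityI subsetI)
      fix U assume "U \<in> \<K>"
      moreover from this K obtain F where "lat_filter m F" "U = spec_open m F"
        by auto
      ultimately show "U \<in> spec_open m ` \<F>"
        by (simp add: \<F>_def)
    qed (auto simp: \<F>_def)
    then have "\<Union>\<K> = spec_open m (filter_gen m (\<Union>\<F>))"
      using spec_open_Union[of \<F> m] unfolding \<F>_def by simp
    then show "\<exists>F. lat_filter m F \<and> \<Union>\<K> = spec_open m F"
      by (intro exI[of _ "filter_gen m (\<Union>\<F>)"]) (simp add: lat_filter_gen)
  qed
  then show ?thesis
    by (simp add: spec_top_def)
qed

lemma topspace_spec_top: "topspace (spec_top m) = Spec_filt m"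
proof -
  have "spec_open m UNIV = Spec_filt m"
    by (auto simp: spec_open_def Spec_filt_def proper_filter_def)
  then have "openin (spec_top m) (Spec_filt m)"
    unfolding openin_spec_top by (intro exI[of _ UNIV]) (simp add: lat_filter_UNIV)
  moreover have "topspace (spec_top m) \<subseteq> Spec_filt m"
    unfolding topspace_def by (auto simp: openin_spec_top spec_open_def)
  ultimately show ?thesis
    by (intro subset_antisym) (auto dest: openin_subset)
qed

text \<open>These conditions determine the codomain up to isomorphism over the map, so a statement about
  the reticulation is one about any map satisfying this predicate.\<close>

definition is_reticulation :: "('a::residuated_lattice \<Rightarrow> 'l::bounded_distrib_lattice) \<Rightarrow> bool" where
  "is_reticulation l \<longleftrightarrow> surj l \<and>
     (\<forall>a b. l (a * b) = inf (l a) (l b)) \<and> (\<forall>a b. l (sup a b) = sup (l a) (l b)) \<and>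
     l bot = bot \<and> l 1 = top \<and>
     (\<forall>a b. l a \<le> l b \<longleftrightarrow> (\<exists>n\<ge>1. a ^ n \<le> b))"

definition tfae :: "bool list \<Rightarrow> bool" where
  "tfae ps \<longleftrightarrow> (\<forall>p\<in>set ps. \<forall>q\<in>set ps. p \<longleftrightarrow> q)"

end

theory Submission
  imports Defs
begin

text \<open>Both kinds of filters are filters of a bounded lattice with a commutative monoid operation
  \<open>m\<close> whose unit is the top element and which distributes over joins: \<open>m\<close> is the product of a
  residuated lattice, or the meet of a bounded distributive lattice. So every condition on prime and
  maximal filters is handled once, for such an \<open>m\<close>, and no homeomorphism between the spectra of
  \<open>A\<close> and of its reticulation is needed.

  Call \<open>z\<close> nilpotent if the filter generated by \<open>z\<close> is improper. The pivot is conormality modulo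
  nilpotents: if \<open>m x y\<close> is nilpotent, then there are \<open>u\<close> and \<open>v\<close> with join \<open>top\<close> such that
  \<open>m u x\<close> and \<open>m v y\<close> are nilpotent. For meets, only \<open>bot\<close> is nilpotent, and this is conormality.
  The reticulation map is onto, preserves joins, turns products into meets, sends exactly the
  nilpotent elements to \<open>bot\<close>, and only \<open>1\<close> to \<open>top\<close>; so the pivot for \<open>A\<close> is conormality of \<open>L\<close>. Finally,
  the principal filters of \<open>x\<close> and \<open>y\<close> have the principal filter of \<open>m x y\<close> as their join and that
  of \<open>sup x y\<close> as their intersection, which turns the pivot into normality of the lattice of principal
  filters, and, since an improper join of two filters is already reached by two of their elements,
  into normality of the lattice of all filters.

  What conormality provides is a separation: if \<open>x \<in> M - N\<close> for maximal filters \<open>M\<close> and \<open>N\<close>, then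
  \<open>m x y\<close> is nilpotent for some \<open>y \<in> N\<close>, and of the two elements \<open>u\<close> and \<open>v\<close> above each prime
  filter contains one, while \<open>u \<notin> M\<close> and \<open>v \<notin> N\<close>. This gives each topological condition. Conversely
  each of these conditions prevents a prime filter from lying below two maximal ones. If conormality
  fails at \<open>x\<close> and \<open>y\<close>, the joins of an element annihilating \<open>x\<close> and one annihilating \<open>y\<close>, up to
  nilpotents, form a set closed under joins without \<open>top\<close>, and a prime filter avoiding this set
  extends to a proper filter with \<open>x\<close> and to one with \<open>y\<close>. The maximal filters above these two are
  different, because no proper filter contains both \<open>x\<close> and \<open>y\<close>.\<close>

section \<open>Filters of an integral lattice-ordered monoid\<close>

locale integral_lattice_monoid =
  fixes m :: "'a::bounded_lattice \<Rightarrow> 'a \<Rightarrow> 'a"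
  assumes m_assoc: "m (m a b) c = m a (m b c)"
    and m_commute: "m a b = m b a"
    and m_top: "m a top = a"
    and m_sup: "m a (sup b c) = sup (m a b) (m a c)"
begin

abbreviation princ :: "'a \<Rightarrow> 'a set" where
  "princ z \<equiv> filter_gen m {z}"

definition nilpotent :: "'a \<Rightarrow> bool" where
  "nilpotent z \<longleftrightarrow> bot \<in> princ z"

definition conormal_mod_nil :: bool where
  "conormal_mod_nil \<longleftrightarrow>
     (\<forall>x y. nilpotent (m x y) \<longrightarrow>
        (\<exists>u v. sup u v = top \<and> nilpotent (m u x) \<and> nilpotent (m v y)))"

lemma m_mono: "b \<le> c \<Longrightarrow> m a b \<le> m a c"
  using m_sup[of a b c] by (metis le_iff_sup)

lemma m_le1: "m a b \<le> a"
  using m_mono[of b top a] by (simp add: m_top)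

lemma m_le2: "m a b \<le> b"
  using m_le1[of b a] by (simp add: m_commute)

lemma m_sup_sup_le: "m (sup a c) (sup b c) \<le> sup (m a b) c"
proof -
  have "m (sup a c) (sup b c) = sup (m (sup a c) b) (m (sup a c) c)"
    by (rule m_sup)
  also have "m (sup a c) b = sup (m a b) (m c b)"
    using m_sup[of b a c] by (simp add: m_commute)
  also have "sup (sup (m a b) (m c b)) (m (sup a c) c) \<le> sup (m a b) c"
    using m_le1[of c b] m_le2[of "sup a c" c] by (meson le_sup_iff order_trans sup_ge1 sup_ge2)
  finally show ?thesis .
qed

lemma filter_m: "lat_filter m F \<Longrightarrow> a \<in> F \<Longrightarrow> b \<in> F \<Longrightarrow> m a b \<in> F"
  by (simp add: lat_filter_def)

lemma filter_up: "lat_filter m F \<Longrightarrow> a \<in> F \<Longrightarrow> a \<le> b \<Longrightarrow> b \<in> F"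
  unfolding lat_filter_def by blast

lemma filter_m_iff: "lat_filter m F \<Longrightarrow> m a b \<in> F \<longleftrightarrow> a \<in> F \<and> b \<in> F"
  using filter_m filter_up m_le1 m_le2 by blast

lemma proper_filter_iff: "proper_filter m F \<longleftrightarrow> lat_filter m F \<and> bot \<notin> F"
  unfolding proper_filter_def using filter_up[of F bot] bot_least by blast

lemma in_princ_iff: "a \<in> princ z \<longleftrightarrow> (\<forall>F. lat_filter m F \<and> z \<in> F \<longrightarrow> a \<in> F)"
  by (auto simp: filter_gen_def)

lemma princ_self: "z \<in> princ z"
  by (simp add: in_princ_iff)

lemma princ_top: "princ top = {top}"
proof -
  have "lat_filter m {top}"
    by (simp add: lat_filter_def m_top top_unique)
  then show ?thesis
    using princ_self[of top] unfolding in_princ_iff by (auto simp: in_princ_iff)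
qed

lemma nilpotent_not_in_proper: "nilpotent z \<Longrightarrow> proper_filter m F \<Longrightarrow> z \<notin> F"
  unfolding nilpotent_def in_princ_iff proper_filter_iff by blast

lemma nilpotent_bot: "nilpotent (m bot y)"
  unfolding nilpotent_def in_princ_iff using filter_m_iff by blast

text \<open>This relative annihilator filter replaces any computation with powers below: adjoining an
  element \<open>b\<close> with \<open>sup b c \<in> F\<close> to \<open>F\<close> never leads outside it.\<close>

lemma lat_filter_residual:
  assumes "lat_filter m F"
  shows "lat_filter m {a. sup a c \<in> F}"
  unfolding lat_filter_def
proof (intro conjI ballI allI impI)
  show "{a. sup a c \<in> F} \<noteq> {}"
    using lat_filter_top[OF assms] by (auto intro!: exI[of _ top])
next
  fix a b assume "a \<in> {a. sup a c \<in> F}" "b \<in> {a. sup a c \<in> F}"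
  then show "m a b \<in> {a. sup a c \<in> F}"
    using filter_up[OF assms _ m_sup_sup_le] filter_m[OF assms] by simp
next
  fix a b assume "a \<in> {a. sup a c \<in> F}" "a \<le> b"
  then show "b \<in> {a. sup a c \<in> F}"
    using filter_up[OF assms, of "sup a c" "sup b c"] by (simp add: le_supI1)
qed

lemma filter_subset_residual: "lat_filter m F \<Longrightarrow> F \<subseteq> {a. sup a c \<in> F}"
  using filter_up[of F _ "sup _ c"] by auto

lemma princ_antimono: "a \<le> b \<Longrightarrow> princ b \<subseteq> princ a"
  unfolding subset_iff in_princ_iff by (metis filter_up)

text \<open>Two annihilator filters absorb \<open>u\<close> and \<open>v\<close> in turn: if \<open>sup u v \<in> F\<close> and \<open>c\<close> lies in every
  filter with \<open>u\<close>, then \<open>sup c v \<in> F\<close>; if \<open>c\<close> also lies in every filter with \<open>v\<close>, then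
  \<open>sup c c \<in> F\<close>.\<close>

lemma princ_Int_princ: "princ u \<inter> princ v = princ (sup u v)"
proof (intro equalityI subsetI)
  fix c assume c: "c \<in> princ u \<inter> princ v"
  show "c \<in> princ (sup u v)"
    unfolding in_princ_iff
  proof (intro allI impI)
    fix F assume F: "lat_filter m F \<and> sup u v \<in> F"
    have "c \<in> {a. sup a v \<in> F}"
      using c F lat_filter_residual[of F v] unfolding Int_iff in_princ_iff by blast
    then have "v \<in> {a. sup a c \<in> F}"
      by (simp add: sup_commute)
    then have "c \<in> {a. sup a c \<in> F}"
      using c F lat_filter_residual[of F c] unfolding Int_iff in_princ_iff by blast
    then show "c \<in> F"
      by simp
  qed
next
  fix c assume "c \<in> princ (sup u v)"
  then show "c \<in> princ u \<inter> princ v"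
    using princ_antimono[OF sup_ge1[of u v]] princ_antimono[OF sup_ge2[of v u]] by blast
qed

lemma princ_Int_princ_trivial: "princ u \<inter> princ v = {top} \<longleftrightarrow> sup u v = top"
  by (metis princ_Int_princ princ_self princ_top singletonD)

lemma nilpotent_sup: "nilpotent a \<Longrightarrow> nilpotent b \<Longrightarrow> nilpotent (sup a b)"
  unfolding nilpotent_def princ_Int_princ[symmetric] by simp

text \<open>Finite character of generation: the right-hand side is itself a filter, because the
  product of \<open>m f f'\<close> and \<open>m g g'\<close> lies below both \<open>m f g\<close> and \<open>m f' g'\<close>.\<close>

lemma filter_join_eq:
  assumes F: "lat_filter m F" and G: "lat_filter m G"
  shows "filter_join m F G = (\<Union>f\<in>F. \<Union>g\<in>G. princ (m f g))"
proof
  let ?J = "\<Union>f\<in>F. \<Union>g\<in>G. princ (m f g)"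
  have "lat_filter m ?J"
    unfolding lat_filter_def
  proof (intro conjI ballI allI impI)
    show "?J \<noteq> {}"
      using lat_filter_top[OF F] lat_filter_top[OF G] princ_self by blast
  next
    fix a b assume "a \<in> ?J" "b \<in> ?J"
    then obtain f g f' g' where fg: "f \<in> F" "g \<in> G" "a \<in> princ (m f g)"
      "f' \<in> F" "g' \<in> G" "b \<in> princ (m f' g')"
      by blast
    have "m a b \<in> princ (m (m f f') (m g g'))"
      using fg(3,6) unfolding in_princ_iff by (metis filter_m_iff)
    then show "m a b \<in> ?J"
      using filter_m[OF F fg(1,4)] filter_m[OF G fg(2,5)] by blast
  next
    fix a b assume "a \<in> ?J" "a \<le> b"
    then show "b \<in> ?J"
      using filter_up[OF lat_filter_gen] by blast
  qed
  moreover have "F \<subseteq> ?J"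
  proof
    fix f assume "f \<in> F"
    then show "f \<in> ?J"
      using lat_filter_top[OF G] princ_self[of f] m_top[of f] by force
  qed
  moreover have "G \<subseteq> ?J"
  proof
    fix g assume "g \<in> G"
    then show "g \<in> ?J"
      using lat_filter_top[OF F] princ_self[of g] m_top[of g] m_commute[of g top] by force
  qed
  ultimately show "filter_join m F G \<subseteq> ?J"
    by (auto simp: filter_join_def filter_gen_def)
  show "?J \<subseteq> filter_join m F G"
    unfolding filter_join_def filter_gen_def
    by (auto simp: in_princ_iff filter_m_iff subset_iff)
qed

lemma lat_filter_join: "lat_filter m (filter_join m F G)"
  by (simp add: filter_join_def lat_filter_gen)

lemma filter_join_upper: "F \<union> G \<subseteq> filter_join m F G"
  by (auto simp: filter_join_def filter_gen_def)

lemma filter_join_UNIV_iff: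
  assumes "lat_filter m F" "lat_filter m G"
  shows "filter_join m F G = UNIV \<longleftrightarrow> (\<exists>f\<in>F. \<exists>g\<in>G. nilpotent (m f g))"
proof -
  have "filter_join m F G = UNIV \<longleftrightarrow> bot \<in> filter_join m F G"
    using proper_filter_iff[of "filter_join m F G"] by (simp add: proper_filter_def lat_filter_join)
  then show ?thesis
    by (simp add: filter_join_eq[OF assms] nilpotent_def)
qed

lemma filter_join_princ_UNIV_iff:
  assumes F: "lat_filter m F"
  shows "filter_join m F (princ x) = UNIV \<longleftrightarrow> (\<exists>f\<in>F. nilpotent (m f x))"
proof -
  have "nilpotent (m f x)" if "g \<in> princ x" "nilpotent (m f g)" for f g
    using that unfolding nilpotent_def in_princ_iff filter_m_iff
    by (metis filter_m_iff)
  then show ?thesis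
    unfolding filter_join_UNIV_iff[OF F lat_filter_gen] using princ_self by blast
qed

lemma filter_join_princ_princ_UNIV_iff:
  "filter_join m (princ x) (princ y) = UNIV \<longleftrightarrow> nilpotent (m x y)"
proof -
  have "nilpotent (m x y)" if "f \<in> princ x" "nilpotent (m f y)" for f
    using that unfolding nilpotent_def in_princ_iff by (metis filter_m_iff)
  then show ?thesis
    unfolding filter_join_princ_UNIV_iff[OF lat_filter_gen] using princ_self by blast
qed

section \<open>Prime and maximal filters\<close>

lemma ex_maximal_disjoint_filter:
  assumes F: "lat_filter m F" and disj: "F \<inter> S = {}"
  obtains P where "lat_filter m P" "F \<subseteq> P" "P \<inter> S = {}"
    "\<And>G. lat_filter m G \<Longrightarrow> P \<subseteq> G \<Longrightarrow> G \<inter> S = {} \<Longrightarrow> G = P"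
proof -
  let ?A = "{G. lat_filter m G \<and> F \<subseteq> G \<and> G \<inter> S = {}}"
  have "\<exists>P\<in>?A. \<forall>G\<in>?A. P \<subseteq> G \<longrightarrow> G = P"
  proof (rule subset_Zorn_nonempty)
    show "?A \<noteq> {}"
      using assms by blast
  next
    fix \<C> assume ne: "\<C> \<noteq> {}" and chain: "subset.chain ?A \<C>"
    then have sub: "\<And>G. G \<in> \<C> \<Longrightarrow> lat_filter m G \<and> F \<subseteq> G \<and> G \<inter> S = {}"
      by (auto simp: subset.chain_def)
    have "lat_filter m (\<Union>\<C>)"
      unfolding lat_filter_def
    proof (intro conjI ballI allI impI)
      show "\<Union>\<C> \<noteq> {}"
        using ne sub lat_filter_top by blast
    next
      fix a b assume "a \<in> \<Union>\<C>" "b \<in> \<Union>\<C>"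
      then obtain G H where GH: "G \<in> \<C>" "H \<in> \<C>" "a \<in> G" "b \<in> H"
        by blast
      with chain have "G \<subseteq> H \<or> H \<subseteq> G"
        unfolding subset_chain_def by blast
      then have "\<exists>K\<in>\<C>. a \<in> K \<and> b \<in> K"
        using GH by blast
      then show "m a b \<in> \<Union>\<C>"
        using sub filter_m by (meson UnionI)
    next
      fix a b assume "a \<in> \<Union>\<C>" "a \<le> b"
      then show "b \<in> \<Union>\<C>"
        using sub filter_up by (meson UnionE UnionI)
    qed
    then show "\<Union>\<C> \<in> ?A"
      using ne sub by blast
  qed
  then obtain P where P: "P \<in> ?A" "\<forall>G\<in>?A. P \<subseteq> G \<longrightarrow> G = P"
    by (rule bexE)
  show ?thesis
  proof (rule that)
    fix G assume "lat_filter m G" "P \<subseteq> G" "G \<inter> S = {}"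
    with P(1) show "G = P"
      by (intro P(2)[rule_format]) auto
  qed (use P(1) in auto)
qed

text \<open>Let \<open>sup a b \<in> P\<close> with neither \<open>a\<close> nor \<open>b\<close> in \<open>P\<close>. The annihilator filter of \<open>b\<close> relative to
  \<open>P\<close> contains \<open>a\<close>, so it meets \<open>S\<close> in some \<open>s\<close>; now the one of \<open>s\<close> contains \<open>b\<close>, so it meets \<open>S\<close>
  in some \<open>t\<close>. Then \<open>sup t s\<close> lies in \<open>P\<close> and in \<open>S\<close>.\<close>

lemma maximal_disjoint_filter_is_prime:
  assumes P: "lat_filter m P" and disj: "P \<inter> S = {}" and ne: "S \<noteq> {}"
    and S: "\<And>s t. s \<in> S \<Longrightarrow> t \<in> S \<Longrightarrow> sup s t \<in> S"
    and max: "\<And>G. lat_filter m G \<Longrightarrow> P \<subseteq> G \<Longrightarrow> G \<inter> S = {} \<Longrightarrow> G = P"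
  shows "P \<in> Spec_filt m"
proof -
  have meets: "\<exists>s\<in>S. sup s c \<in> P" if "sup a c \<in> P" "a \<notin> P" for a c
  proof (rule ccontr)
    assume "\<not> (\<exists>s\<in>S. sup s c \<in> P)"
    then have "{a. sup a c \<in> P} = P"
      using P by (intro max lat_filter_residual filter_subset_residual) auto
    with that show False
      by blast
  qed
  have "a \<in> P \<or> b \<in> P" if ab: "sup a b \<in> P" for a b
  proof (rule ccontr)
    assume nin: "\<not> (a \<in> P \<or> b \<in> P)"
    then obtain s where s: "s \<in> S" "sup s b \<in> P"
      using meets[OF ab] by blast
    then have "sup b s \<in> P"
      by (simp add: sup_commute)
    with nin obtain t where "t \<in> S" "sup t s \<in> P"
      using meets by blast
    with s disj S show False
      by blast
  qed
  moreover have "P \<noteq> UNIV"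
    using disj ne by auto
  ultimately show ?thesis
    using P by (simp add: Spec_filt_def proper_filter_def)
qed

lemma ex_prime_filter_disjoint:
  assumes "lat_filter m F" "F \<inter> S = {}" "S \<noteq> {}"
    and "\<And>s t. s \<in> S \<Longrightarrow> t \<in> S \<Longrightarrow> sup s t \<in> S"
  obtains P where "P \<in> Spec_filt m" "F \<subseteq> P" "P \<inter> S = {}"
proof -
  obtain P where P: "lat_filter m P" "F \<subseteq> P" "P \<inter> S = {}"
    "\<And>G. lat_filter m G \<Longrightarrow> P \<subseteq> G \<Longrightarrow> G \<inter> S = {} \<Longrightarrow> G = P"
    using ex_maximal_disjoint_filter[OF assms(1,2)] by blast
  have "P \<in> Spec_filt m"
    by (rule maximal_disjoint_filter_is_prime[OF P(1,3) assms(3,4) P(4)])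
  then show ?thesis
    using P(2,3) by (rule that)
qed

lemma Max_filt_prime:
  assumes "M \<in> Max_filt m"
  shows "M \<in> Spec_filt m"
proof (rule maximal_disjoint_filter_is_prime)
  show "lat_filter m M" "M \<inter> {bot} = {}"
    using assms by (auto simp: Max_filt_def proper_filter_iff)
  fix G assume "lat_filter m G" "M \<subseteq> G" "G \<inter> {bot} = {}"
  then show "G = M"
    using assms by (auto simp: Max_filt_def proper_filter_iff)
qed auto

lemma ex_Max_filt_above:
  assumes "proper_filter m F"
  obtains M where "M \<in> Max_filt m" "F \<subseteq> M"
proof -
  have F: "lat_filter m F" "F \<inter> {bot} = {}"
    using assms by (auto simp: proper_filter_iff)
  obtain M where M: "lat_filter m M" "F \<subseteq> M" "M \<inter> {bot} = {}"
    "\<And>G. lat_filter m G \<Longrightarrow> M \<subseteq> G \<Longrightarrow> G \<inter> {bot} = {} \<Longrightarrow> G = M"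
    using ex_maximal_disjoint_filter[OF F] by blast
  then have "M \<in> Max_filt m"
    by (auto simp: Max_filt_def proper_filter_iff)
  then show ?thesis
    using M(2) by (rule that)
qed

lemma SpecD:
  assumes "P \<in> Spec_filt m"
  shows Spec_filter: "lat_filter m P" and Spec_proper: "proper_filter m P"
    and Spec_prime: "sup a b \<in> P \<Longrightarrow> a \<in> P \<or> b \<in> P"
  using assms by (auto simp: Spec_filt_def proper_filter_def)

lemma Max_subset_eq: "M \<in> Max_filt m \<Longrightarrow> N \<in> Max_filt m \<Longrightarrow> M \<subseteq> N \<Longrightarrow> N = M"
  by (auto simp: Max_filt_def)

lemma nilpotent_not_both_in_Spec:
  "nilpotent (m a b) \<Longrightarrow> P \<in> Spec_filt m \<Longrightarrow> a \<in> P \<Longrightarrow> b \<notin> P"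
  using nilpotent_not_in_proper[of "m a b" P] Spec_proper[of P] filter_m[OF Spec_filter, of P a b]
  by blast

lemma Max_not_in_imp_nilpotent:
  assumes M: "M \<in> Max_filt m" and x: "x \<notin> M"
  obtains y where "y \<in> M" "nilpotent (m y x)"
proof -
  have F: "lat_filter m M"
    by (rule Spec_filter[OF Max_filt_prime[OF M]])
  have "filter_join m M (princ x) = UNIV"
  proof (rule ccontr)
    assume "filter_join m M (princ x) \<noteq> UNIV"
    then have "proper_filter m (filter_join m M (princ x))"
      by (simp add: proper_filter_def lat_filter_join)
    then have "filter_join m M (princ x) = M"
      using M filter_join_upper[of M "princ x"] by (simp add: Max_filt_def)
    then show False
      using x princ_self[of x] filter_join_upper[of M "princ x"] by blast
  qed
  then show ?thesis
    using that unfolding filter_join_princ_UNIV_iff[OF F] by blast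
qed

text \<open>Used as follows: every prime filter contains \<open>u\<close> or \<open>v\<close>, a prime filter with \<open>f\<close> omits \<open>u\<close>, and one below \<open>M\<close>
  omits \<open>v\<close>.\<close>

lemma conormal_separation:
  assumes C: conormal_mod_nil and M: "M \<in> Max_filt m" and f: "f \<notin> M"
  obtains u v where "sup u v = top" "nilpotent (m u f)" "v \<notin> M"
proof -
  obtain g where g: "g \<in> M" "nilpotent (m f g)"
    using Max_not_in_imp_nilpotent[OF M f] m_commute by metis
  then obtain u v where uv: "sup u v = top" "nilpotent (m u f)" "nilpotent (m v g)"
    using C unfolding conormal_mod_nil_def by blast
  then have "v \<notin> M"
    using g(1) nilpotent_not_both_in_Spec[OF uv(3) Max_filt_prime[OF M]] by blast
  with uv show ?thesis
    using that by blast
qed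

lemma Spec_split:
  "sup u v = top \<Longrightarrow> P \<in> Spec_filt m \<Longrightarrow> v \<notin> P \<Longrightarrow> u \<in> P"
  using lat_filter_top[OF Spec_filter, of P] Spec_prime[of P u v] by auto

section \<open>The Stone topology\<close>

lemma closedin_spec_top_iff:
  "closedin (spec_top m) C \<longleftrightarrow> (\<exists>F. lat_filter m F \<and> C = {P \<in> Spec_filt m. F \<subseteq> P})"
proof
  assume "closedin (spec_top m) C"
  then obtain F where C: "C \<subseteq> Spec_filt m" and F: "lat_filter m F" "Spec_filt m - C = spec_open m F"
    unfolding closedin_def topspace_spec_top openin_spec_top by blast
  have "C = Spec_filt m - spec_open m F"
    using C F(2) by blast
  also have "\<dots> = {P \<in> Spec_filt m. F \<subseteq> P}"
    by (auto simp: spec_open_def)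
  finally show "\<exists>F. lat_filter m F \<and> C = {P \<in> Spec_filt m. F \<subseteq> P}"
    using F(1) by blast
next
  assume "\<exists>F. lat_filter m F \<and> C = {P \<in> Spec_filt m. F \<subseteq> P}"
  then obtain F where F: "lat_filter m F" "C = {P \<in> Spec_filt m. F \<subseteq> P}"
    by blast
  then have "Spec_filt m - C = spec_open m F"
    by (auto simp: spec_open_def)
  with F show "closedin (spec_top m) C"
    unfolding closedin_def topspace_spec_top openin_spec_top by blast
qed

lemma closedin_Max:
  assumes "M \<in> Max_filt m"
  shows "closedin (spec_top m) {M}"
proof -
  have "{M} = {P \<in> Spec_filt m. M \<subseteq> P}"
    using assms Max_filt_prime[OF assms] Spec_proper by (auto simp: Max_filt_def)
  then show ?thesis
    unfolding closedin_spec_top_iff using Spec_filter[OF Max_filt_prime[OF assms]] by blast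
qed

lemma open_down_closed:
  "openin (spec_top m) U \<Longrightarrow> M \<in> U \<Longrightarrow> P \<in> Spec_filt m \<Longrightarrow> P \<subseteq> M \<Longrightarrow> P \<in> U"
  unfolding openin_spec_top by (auto simp: spec_open_def)

lemma open_not_containing: "openin (spec_top m) {P \<in> Spec_filt m. u \<notin> P}"
proof -
  have "princ u \<subseteq> P \<longleftrightarrow> u \<in> P" if "P \<in> Spec_filt m" for P
    using that Spec_filter princ_self[of u] by (auto simp: in_princ_iff)
  then have "{P \<in> Spec_filt m. u \<notin> P} = spec_open m (princ u)"
    by (auto simp: spec_open_def)
  then show ?thesis
    unfolding openin_spec_top using lat_filter_gen by blast
qed

section \<open>Conormality modulo nilpotents and the spectrum\<close>

lemma conormal_if_unique_Max:
  assumes uniq: "\<forall>P\<in>Spec_filt m. \<exists>!M. M \<in> Max_filt m \<and> P \<subseteq> M"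
  shows conormal_mod_nil
  unfolding conormal_mod_nil_def
proof (intro allI impI, rule ccontr)
  fix x y assume xy: "nilpotent (m x y)"
    and no: "\<nexists>u v. sup u v = top \<and> nilpotent (m u x) \<and> nilpotent (m v y)"
  \<comment> \<open>A prime filter \<open>P\<close> avoiding this set is disjoint from the annihilators, up to nilpotents, of \<open>x\<close>
      and of \<open>y\<close>, so each of \<open>x\<close> and \<open>y\<close> can be added to \<open>P\<close> without making it improper.\<close>
  let ?S = "{sup u v | u v. nilpotent (m u x) \<and> nilpotent (m v y)}"
  have ann_sup: "nilpotent (m (sup a b) z)" if "nilpotent (m a z)" "nilpotent (m b z)" for a b z
    using nilpotent_sup[OF that] m_sup[of z a b] by (simp add: m_commute)
  have top: "lat_filter m {top}"
    by (simp add: lat_filter_def m_top top_unique)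
  have bot: "sup u bot \<in> ?S" if "nilpotent (m u x)" for u
    using that nilpotent_bot[of y] by blast
  have bot': "sup bot v \<in> ?S" if "nilpotent (m v y)" for v
    using that nilpotent_bot[of x] by blast
  obtain P where P: "P \<in> Spec_filt m" "P \<inter> ?S = {}"
  proof (rule ex_prime_filter_disjoint[OF top])
    show "{top} \<inter> ?S = {}"
    proof (rule ccontr)
      assume "{top} \<inter> ?S \<noteq> {}"
      then obtain u v where "top = sup u v" "nilpotent (m u x)" "nilpotent (m v y)"
        by blast
      with no show False
        by metis
    qed
    show "?S \<noteq> {}"
      using bot[OF nilpotent_bot] by blast
    fix s t assume "s \<in> ?S" "t \<in> ?S"
    then obtain u v u' v' where *: "s = sup u v" "t = sup u' v'"
      "nilpotent (m u x)" "nilpotent (m v y)" "nilpotent (m u' x)" "nilpotent (m v' y)"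
      by blast
    have "sup s t = sup (sup u u') (sup v v')"
      by (simp add: * ac_simps)
    then show "sup s t \<in> ?S"
      using ann_sup * by blast
  qed
  have extend: "\<exists>M\<in>Max_filt m. P \<subseteq> M \<and> z \<in> M" if z: "\<And>p. p \<in> P \<Longrightarrow> \<not> nilpotent (m p z)" for z
  proof -
    have "proper_filter m (filter_join m P (princ z))"
      using z filter_join_princ_UNIV_iff[OF Spec_filter[OF P(1)]]
      by (auto simp: proper_filter_def lat_filter_join)
    then obtain M where "M \<in> Max_filt m" "filter_join m P (princ z) \<subseteq> M"
      by (rule ex_Max_filt_above)
    then show ?thesis
      using filter_join_upper[of P "princ z"] princ_self[of z] by blast
  qed
  have "\<not> nilpotent (m p x)" if "p \<in> P" for p
    using bot[of p] that P(2) by auto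
  then obtain M where M: "M \<in> Max_filt m" "P \<subseteq> M" "x \<in> M"
    using extend by blast
  have "\<not> nilpotent (m p y)" if "p \<in> P" for p
    using bot'[of p] that P(2) by auto
  then obtain N where N: "N \<in> Max_filt m" "P \<subseteq> N" "y \<in> N"
    using extend by blast
  have "M = N"
    using uniq P(1) M N by blast
  then show False
    using xy M N nilpotent_not_both_in_Spec Max_filt_prime by blast
qed

lemma unique_MaxI:
  assumes "\<And>P M N. P \<in> Spec_filt m \<Longrightarrow> M \<in> Max_filt m \<Longrightarrow> N \<in> Max_filt m \<Longrightarrow>
    P \<subseteq> M \<Longrightarrow> P \<subseteq> N \<Longrightarrow> M = N"
  shows "\<forall>P\<in>Spec_filt m. \<exists>!M. M \<in> Max_filt m \<and> P \<subseteq> M"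
proof
  fix P assume P: "P \<in> Spec_filt m"
  then obtain M where "M \<in> Max_filt m" "P \<subseteq> M"
    using ex_Max_filt_above[OF Spec_proper] by blast
  then show "\<exists>!M. M \<in> Max_filt m \<and> P \<subseteq> M"
    using assms[OF P] by blast
qed

lemma conormal_imp_normal_space:
  assumes C: conormal_mod_nil
  shows "normal_space (spec_top m)"
  unfolding normal_space_def
proof (intro allI impI, elim conjE)
  fix S T assume "closedin (spec_top m) S" "closedin (spec_top m) T" and disj: "disjnt S T"
  then obtain F G where F: "lat_filter m F" "S = {P \<in> Spec_filt m. F \<subseteq> P}"
    and G: "lat_filter m G" "T = {P \<in> Spec_filt m. G \<subseteq> P}"
    unfolding closedin_spec_top_iff by blast
  have "filter_join m F G = UNIV"
  proof (rule ccontr)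
    assume "filter_join m F G \<noteq> UNIV"
    then obtain M where M: "M \<in> Max_filt m" "filter_join m F G \<subseteq> M"
      using ex_Max_filt_above[of "filter_join m F G"]
      by (auto simp: proper_filter_def lat_filter_join)
    then have "M \<in> S \<inter> T"
      using F(2) G(2) Max_filt_prime filter_join_upper[of F G] by blast
    with disj show False
      by (auto simp: disjnt_def)
  qed
  then obtain f g where fg: "f \<in> F" "g \<in> G" "nilpotent (m f g)"
    using filter_join_UNIV_iff F(1) G(1) by blast
  then obtain u v where uv: "sup u v = top" "nilpotent (m u f)" "nilpotent (m v g)"
    using C unfolding conormal_mod_nil_def by blast
  let ?U = "{P \<in> Spec_filt m. u \<notin> P}" and ?V = "{P \<in> Spec_filt m. v \<notin> P}"
  have "S \<subseteq> ?U" "T \<subseteq> ?V"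
    using fg uv nilpotent_not_both_in_Spec F(2) G(2) by blast+
  moreover have "disjnt ?U ?V"
    using Spec_split[OF uv(1)] by (auto simp: disjnt_def)
  ultimately show "\<exists>U V. openin (spec_top m) U \<and> openin (spec_top m) V \<and>
      S \<subseteq> U \<and> T \<subseteq> V \<and> disjnt U V"
    by (intro exI[of _ ?U] exI[of _ ?V] conjI open_not_containing)
qed

lemma normal_space_imp_Max_separated:
  assumes "normal_space (spec_top m)"
  shows "\<forall>M\<in>Max_filt m. \<forall>N\<in>Max_filt m. M \<noteq> N \<longrightarrow>
    (\<exists>U V. openin (spec_top m) U \<and> openin (spec_top m) V \<and> M \<in> U \<and> N \<in> V \<and> disjnt U V)"
proof (intro ballI impI)
  fix M N assume "M \<in> Max_filt m" "N \<in> Max_filt m" "M \<noteq> N"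
  then show "\<exists>U V. openin (spec_top m) U \<and> openin (spec_top m) V \<and> M \<in> U \<and> N \<in> V \<and> disjnt U V"
    using assms[unfolded normal_space_def, rule_format, of "{M}" "{N}"] closedin_Max by simp
qed

lemma Max_separated_imp_unique_Max:
  assumes sep: "\<forall>M\<in>Max_filt m. \<forall>N\<in>Max_filt m. M \<noteq> N \<longrightarrow>
    (\<exists>U V. openin (spec_top m) U \<and> openin (spec_top m) V \<and> M \<in> U \<and> N \<in> V \<and> disjnt U V)"
  shows "\<forall>P\<in>Spec_filt m. \<exists>!M. M \<in> Max_filt m \<and> P \<subseteq> M"
proof (rule unique_MaxI, rule ccontr)
  fix P M N assume P: "P \<in> Spec_filt m" "P \<subseteq> M" "P \<subseteq> N"
    and MN: "M \<in> Max_filt m" "N \<in> Max_filt m" "M \<noteq> N"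
  obtain U V where U: "openin (spec_top m) U" "M \<in> U" and V: "openin (spec_top m) V" "N \<in> V"
    and "disjnt U V"
    using sep[rule_format, OF MN] by blast
  moreover have "P \<in> U" "P \<in> V"
    using open_down_closed[OF U P(1,2)] open_down_closed[OF V P(1,3)] by simp_all
  ultimately show False
    by (auto simp: disjnt_def)
qed

lemma conormal_iff_unique_Max:
  "conormal_mod_nil \<longleftrightarrow> (\<forall>P\<in>Spec_filt m. \<exists>!M. M \<in> Max_filt m \<and> P \<subseteq> M)"
  by (rule iffI)
    (erule Max_separated_imp_unique_Max[OF normal_space_imp_Max_separated[OF
        conormal_imp_normal_space]],
      erule conormal_if_unique_Max)

lemma conormal_iff_normal_space: "conormal_mod_nil \<longleftrightarrow> normal_space (spec_top m)"
  by (rule iffI)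
    (erule conormal_imp_normal_space,
      erule conormal_if_unique_Max[OF Max_separated_imp_unique_Max[OF normal_space_imp_Max_separated]])

lemma conormal_iff_Max_separated:
  "conormal_mod_nil \<longleftrightarrow> (\<forall>M\<in>Max_filt m. \<forall>N\<in>Max_filt m. M \<noteq> N \<longrightarrow>
    (\<exists>U V. openin (spec_top m) U \<and> openin (spec_top m) V \<and> M \<in> U \<and> N \<in> V \<and> disjnt U V))"
  by (rule iffI)
    (erule normal_space_imp_Max_separated[OF conormal_imp_normal_space],
      erule conormal_if_unique_Max[OF Max_separated_imp_unique_Max])

lemma conormal_imp_retract:
  assumes C: conormal_mod_nil
  shows "Max_filt m retract_of_space spec_top m"
proof -
  have uniq: "\<forall>P\<in>Spec_filt m. \<exists>!M. M \<in> Max_filt m \<and> P \<subseteq> M"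
    using C by (simp only: conormal_iff_unique_Max)
  define r where "r P = (THE M. M \<in> Max_filt m \<and> P \<subseteq> M)" for P
  have r: "r P \<in> Max_filt m" "P \<subseteq> r P" if "P \<in> Spec_filt m" for P
    using theI'[OF uniq[rule_format, OF that]] by (simp_all add: r_def)
  have "continuous_map (spec_top m) (subtopology (spec_top m) (Max_filt m)) r"
    unfolding continuous_map_in_subtopology
  proof
    show "r \<in> topspace (spec_top m) \<rightarrow> Max_filt m"
      using r by (auto simp: topspace_spec_top)
    show "continuous_map (spec_top m) (spec_top m) r"
      unfolding continuous_map
    proof (intro conjI allI impI)
      show "r ` topspace (spec_top m) \<subseteq> topspace (spec_top m)"
        using r Max_filt_prime by (auto simp: topspace_spec_top)
    next
      fix U assume "openin (spec_top m) U"
      then obtain F where F: "U = spec_open m F"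
        unfolding openin_spec_top by blast
      show "openin (spec_top m) {P \<in> topspace (spec_top m). r P \<in> U}"
      proof (subst openin_subopen, intro ballI)
        fix P assume "P \<in> {P \<in> topspace (spec_top m). r P \<in> U}"
        then have P: "P \<in> Spec_filt m" and "r P \<in> U"
          by (auto simp: topspace_spec_top)
        then obtain f where f: "f \<in> F" "f \<notin> r P"
          by (auto simp: F spec_open_def)
        then obtain u v where uv: "sup u v = top" "nilpotent (m u f)" "v \<notin> r P"
          using conormal_separation[OF C r(1)[OF P]] by blast
        let ?V = "{Q \<in> Spec_filt m. v \<notin> Q}"
        have "P \<in> ?V"
          using P uv(3) r(2) by blast
        moreover have "?V \<subseteq> {P \<in> topspace (spec_top m). r P \<in> U}"
        proof
          fix Q assume Q: "Q \<in> ?V"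
          then have rQ: "r Q \<in> Spec_filt m"
            using r Max_filt_prime by blast
          have "u \<in> r Q"
            using Q Spec_split[OF uv(1)] r(2) by blast
          then have "f \<notin> r Q"
            using uv(2) rQ nilpotent_not_both_in_Spec by blast
          with f(1) rQ Q show "Q \<in> {P \<in> topspace (spec_top m). r P \<in> U}"
            by (auto simp: F spec_open_def topspace_spec_top)
        qed
        ultimately show "\<exists>T. openin (spec_top m) T \<and> P \<in> T \<and>
            T \<subseteq> {P \<in> topspace (spec_top m). r P \<in> U}"
          using open_not_containing by blast
      qed
    qed
  qed
  moreover have "r M = M" if "M \<in> Max_filt m" for M
    using Max_subset_eq[OF that r(1)] r(2)[of M] Max_filt_prime[OF that] by blast
  moreover have "Max_filt m \<subseteq> topspace (spec_top m)"
    using Max_filt_prime by (auto simp: topspace_spec_top)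
  ultimately show ?thesis
    unfolding retract_of_space_def by blast
qed

text \<open>A retraction \<open>r\<close> sends a prime \<open>P\<close> to every maximal \<open>M\<close> above it: the fibre over the closed point
  \<open>r P\<close> is closed and contains \<open>P\<close>, and closed sets are upward closed.\<close>

lemma retract_imp_unique_Max:
  assumes "Max_filt m retract_of_space spec_top m"
  shows "\<forall>P\<in>Spec_filt m. \<exists>!M. M \<in> Max_filt m \<and> P \<subseteq> M"
proof -
  obtain r where r: "continuous_map (spec_top m) (subtopology (spec_top m) (Max_filt m)) r"
    and r_Max: "\<And>M. M \<in> Max_filt m \<Longrightarrow> r M = M"
    using assms unfolding retract_of_space_def by blast
  have eq: "r P = M" if P: "P \<in> Spec_filt m" "M \<in> Max_filt m" "P \<subseteq> M" for P M
  proof -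
    have rP: "r P \<in> Max_filt m" and cont: "continuous_map (spec_top m) (spec_top m) r"
      using r P(1) by (auto simp: continuous_map_in_subtopology topspace_spec_top)
    let ?C = "{Q \<in> topspace (spec_top m). r Q \<in> {r P}}"
    have "closedin (spec_top m) ?C"
      using closedin_continuous_map_preimage[OF cont closedin_Max[OF rP]] .
    then obtain F where F: "?C = {Q \<in> Spec_filt m. F \<subseteq> Q}"
      unfolding closedin_spec_top_iff by blast
    have "P \<in> ?C"
      using P(1) by (simp add: topspace_spec_top)
    then have "M \<in> ?C"
      using F P Max_filt_prime by auto
    then show ?thesis
      using r_Max[OF P(2)] by simp
  qed
  show ?thesis
    by (rule unique_MaxI) (use eq in blast)
qed

lemma conormal_iff_retract: "conormal_mod_nil \<longleftrightarrow> Max_filt m retract_of_space spec_top m"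
  by (rule iffI)
    (erule conormal_imp_retract,
      erule conormal_if_unique_Max[OF retract_imp_unique_Max])

lemma conormal_imp_Inter_below_Max:
  assumes C: conormal_mod_nil
  shows "\<forall>M\<in>Max_filt m. {N \<in> Max_filt m. \<Inter>{P \<in> Spec_filt m. P \<subseteq> M} \<subseteq> N} = {M}"
proof
  fix M assume M: "M \<in> Max_filt m"
  have "N = M" if N: "N \<in> Max_filt m" "\<Inter>{P \<in> Spec_filt m. P \<subseteq> M} \<subseteq> N" for N
  proof (rule ccontr)
    assume "N \<noteq> M"
    then obtain f where f: "f \<in> N" "f \<notin> M"
      using M N(1) Max_subset_eq by blast
    then obtain u v where uv: "sup u v = top" "nilpotent (m u f)" "v \<notin> M"
      using conormal_separation[OF C M] by blast
    have "u \<in> \<Inter>{P \<in> Spec_filt m. P \<subseteq> M}"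
      using Spec_split[OF uv(1)] uv(3) by blast
    then have "u \<in> N"
      using N(2) by blast
    then show False
      using f(1) uv(2) nilpotent_not_both_in_Spec Max_filt_prime[OF N(1)] by blast
  qed
  moreover have "\<Inter>{P \<in> Spec_filt m. P \<subseteq> M} \<subseteq> M"
    using Max_filt_prime[OF M] by blast
  ultimately show "{N \<in> Max_filt m. \<Inter>{P \<in> Spec_filt m. P \<subseteq> M} \<subseteq> N} = {M}"
    using M by blast
qed

text \<open>The primes below \<open>M\<close> are those containing the intersection \<open>?K\<close> of all of them: a maximal
  filter above a prime that contains \<open>?K\<close> contains \<open>?K\<close> too, so it is \<open>M\<close>.\<close>

lemma Inter_below_Max_imp_closed:
  assumes "\<forall>M\<in>Max_filt m. {N \<in> Max_filt m. \<Inter>{P \<in> Spec_filt m. P \<subseteq> M} \<subseteq> N} = {M}"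
  shows "\<forall>M\<in>Max_filt m. closedin (spec_top m) {P \<in> Spec_filt m. P \<subseteq> M}"
proof
  fix M assume M: "M \<in> Max_filt m"
  let ?K = "\<Inter>{P \<in> Spec_filt m. P \<subseteq> M}"
  have "Q \<subseteq> M" if Q: "Q \<in> Spec_filt m" "?K \<subseteq> Q" for Q
  proof -
    obtain N where N: "N \<in> Max_filt m" "Q \<subseteq> N"
      using ex_Max_filt_above[OF Spec_proper[OF Q(1)]] .
    then have "N \<in> {N \<in> Max_filt m. ?K \<subseteq> N}"
      using Q(2) by blast
    then have "N = M"
      using assms M by blast
    with N(2) show ?thesis
      by blast
  qed
  then have "{P \<in> Spec_filt m. P \<subseteq> M} = {Q \<in> Spec_filt m. ?K \<subseteq> Q}"
    by blast
  moreover have "lat_filter m ?K"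
    by (rule lat_filter_Inter) (auto dest: Spec_filter)
  ultimately show "closedin (spec_top m) {P \<in> Spec_filt m. P \<subseteq> M}"
    unfolding closedin_spec_top_iff by blast
qed

lemma closed_imp_unique_Max:
  assumes closed: "\<forall>M\<in>Max_filt m. closedin (spec_top m) {P \<in> Spec_filt m. P \<subseteq> M}"
  shows "\<forall>P\<in>Spec_filt m. \<exists>!M. M \<in> Max_filt m \<and> P \<subseteq> M"
proof (rule unique_MaxI)
  fix P M N assume P: "P \<in> Spec_filt m" "P \<subseteq> M" "P \<subseteq> N"
    and MN: "M \<in> Max_filt m" "N \<in> Max_filt m"
  obtain F where F: "{P \<in> Spec_filt m. P \<subseteq> M} = {P \<in> Spec_filt m. F \<subseteq> P}"
    using closed MN(1) unfolding closedin_spec_top_iff by blast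
  then have "F \<subseteq> N"
    using P by blast
  then have "N \<subseteq> M"
    using F Max_filt_prime[OF MN(2)] by blast
  then show "M = N"
    using MN Max_subset_eq by blast
qed

lemma conormal_iff_closed:
  "conormal_mod_nil \<longleftrightarrow> (\<forall>M\<in>Max_filt m. closedin (spec_top m) {P \<in> Spec_filt m. P \<subseteq> M})"
  by (rule iffI)
    (erule Inter_below_Max_imp_closed[OF conormal_imp_Inter_below_Max],
      erule conormal_if_unique_Max[OF closed_imp_unique_Max])

lemma conormal_iff_Inter_below_Max:
  "conormal_mod_nil \<longleftrightarrow>
    (\<forall>M\<in>Max_filt m. {N \<in> Max_filt m. \<Inter>{P \<in> Spec_filt m. P \<subseteq> M} \<subseteq> N} = {M})"
  by (rule iffI)
    (erule conormal_imp_Inter_below_Max,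
      erule conormal_if_unique_Max[OF closed_imp_unique_Max[OF Inter_below_Max_imp_closed]])

lemmas conormal_iff_spectral_conditions =
  conormal_iff_unique_Max conormal_iff_retract conormal_iff_normal_space
  conormal_iff_closed conormal_iff_Inter_below_Max conormal_iff_Max_separated

section \<open>Conormality modulo nilpotents and the lattices of filters\<close>

lemma conormal_iff_normal_princ:
  "conormal_mod_nil \<longleftrightarrow> normal_lattice (range princ) (filter_join m) (\<inter>) {top} UNIV"
  by (simp add: conormal_mod_nil_def normal_lattice_def filter_join_princ_princ_UNIV_iff
      princ_Int_princ_trivial)

lemma conormal_iff_normal_filters:
  "conormal_mod_nil \<longleftrightarrow> normal_lattice {F. lat_filter m F} (filter_join m) (\<inter>) {top} UNIV"
proof
  assume C: conormal_mod_nil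
  show "normal_lattice {F. lat_filter m F} (filter_join m) (\<inter>) {top} UNIV"
    unfolding normal_lattice_def
  proof (intro ballI impI)
    fix F G assume F: "F \<in> {F. lat_filter m F}" and G: "G \<in> {F. lat_filter m F}"
      and "filter_join m F G = UNIV"
    then obtain f g where fg: "f \<in> F" "g \<in> G" "nilpotent (m f g)"
      using filter_join_UNIV_iff by blast
    then obtain u v where uv: "sup u v = top" "nilpotent (m u f)" "nilpotent (m v g)"
      using C unfolding conormal_mod_nil_def by blast
    have "filter_join m (princ u) F = UNIV" "filter_join m (princ v) G = UNIV"
      using F G fg(1,2) uv(2,3) princ_self[of u] princ_self[of v] filter_join_UNIV_iff[OF lat_filter_gen]
      by blast+
    then show "\<exists>U\<in>{F. lat_filter m F}. \<exists>V\<in>{F. lat_filter m F}.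
        U \<inter> V = {top} \<and> filter_join m U F = UNIV \<and> filter_join m V G = UNIV"
      using uv(1) unfolding princ_Int_princ_trivial[symmetric]
      by (intro bexI[of _ "princ u"] bexI[of _ "princ v"] conjI) (simp_all add: lat_filter_gen)
  qed
next
  assume N: "normal_lattice {F. lat_filter m F} (filter_join m) (\<inter>) {top} UNIV"
  show conormal_mod_nil
    unfolding conormal_mod_nil_def
  proof (intro allI impI)
    fix x y assume "nilpotent (m x y)"
    then have "filter_join m (princ x) (princ y) = UNIV"
      by (simp add: filter_join_princ_princ_UNIV_iff)
    then obtain U V where UV: "lat_filter m U" "lat_filter m V" "U \<inter> V = {top}"
      "filter_join m U (princ x) = UNIV" "filter_join m V (princ y) = UNIV"
      using N[unfolded normal_lattice_def, rule_format, of "princ x" "princ y"]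
      by (auto simp: lat_filter_gen)
    then obtain u v where uv: "u \<in> U" "nilpotent (m u x)" "v \<in> V" "nilpotent (m v y)"
      unfolding UV(1,2)[THEN filter_join_princ_UNIV_iff] by blast
    then have "sup u v \<in> U \<inter> V"
      using filter_up[OF UV(1) _ sup_ge1] filter_up[OF UV(2) _ sup_ge2] by blast
    then show "\<exists>u v. sup u v = top \<and> nilpotent (m u x) \<and> nilpotent (m v y)"
      using UV(3) uv by blast
  qed
qed

end

section \<open>Residuated lattices, distributive lattices and the reticulation\<close>

lemma residuated_mult_mono:
  fixes a b c :: "'a::residuated_lattice"
  assumes "b \<le> c"
  shows "a * b \<le> a * c"
proof -
  have "c \<le> residuum a (a * c)"
    by (simp add: residuation mult.commute)
  with assms have "b \<le> residuum a (a * c)"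
    by (rule order_trans)
  then show ?thesis
    by (simp add: residuation mult.commute)
qed

text \<open>Multiplication by \<open>a\<close> preserves joins because it has the residuum as an upper adjoint.\<close>

interpretation residuated:
  integral_lattice_monoid "(*) :: 'a::residuated_lattice \<Rightarrow> 'a \<Rightarrow> 'a"
proof
  fix a b c :: 'a
  show "a * b * c = a * (b * c)" "a * b = b * a"
    by (simp_all add: ac_simps)
  show "a * top = a"
    by (simp flip: one_eq_top)
  show "a * sup b c = sup (a * b) (a * c)"
  proof (rule order_antisym)
    have "sup b c \<le> residuum a (sup (a * b) (a * c))"
      by (intro sup_least) (simp_all add: residuation mult.commute)
    then show "a * sup b c \<le> sup (a * b) (a * c)"
      by (simp add: residuation mult.commute)
    show "sup (a * b) (a * c) \<le> a * sup b c"
      by (intro sup_least residuated_mult_mono) simp_all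
  qed
qed

interpretation distributive:
  integral_lattice_monoid "inf :: 'a::bounded_distrib_lattice \<Rightarrow> 'a \<Rightarrow> 'a"
  by standard (simp_all add: inf_sup_distrib1 ac_simps)

lemma filter_power:
  assumes F: "lat_filter (*) F" and a: "(a::'a::residuated_lattice) \<in> F"
  shows "a ^ n \<in> F"
proof (induction n)
  case 0
  then show ?case
    using lat_filter_top[OF F] by (simp add: one_eq_top)
next
  case (Suc n)
  then show ?case
    using residuated.filter_m[OF F a] by simp
qed

lemma principal_filt_eq_filter_gen: "principal_filt x = filter_gen (*) {x}"
proof (intro equalityI subsetI)
  fix a assume "a \<in> principal_filt x"
  then obtain n where "x ^ n \<le> a"
    by (auto simp: principal_filt_def)
  then show "a \<in> filter_gen (*) {x}"
    unfolding residuated.in_princ_iff by (meson filter_power residuated.filter_up)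
next
  have "lat_filter (*) (principal_filt x)"
    unfolding lat_filter_def
  proof (intro conjI ballI allI impI)
    show "principal_filt x \<noteq> {}"
      by (auto simp: principal_filt_def intro!: exI[of _ "x ^ 1"] exI[of _ "1::nat"])
  next
    fix a b assume "a \<in> principal_filt x" "b \<in> principal_filt x"
    then obtain n k where nk: "n \<ge> 1" "k \<ge> 1" "x ^ n \<le> a" "x ^ k \<le> b"
      by (auto simp: principal_filt_def)
    have "x ^ (n + k) \<le> x ^ n * b"
      unfolding power_add by (rule residuated_mult_mono[OF nk(4)])
    also have "\<dots> \<le> a * b"
      using residuated_mult_mono[OF nk(3), of b] by (simp add: mult.commute)
    finally show "a * b \<in> principal_filt x"
      using nk(1) by (auto simp: principal_filt_def intro!: exI[of _ "n + k"])
  next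
    fix a b assume "a \<in> principal_filt x" "a \<le> b"
    then show "b \<in> principal_filt x"
      by (auto simp: principal_filt_def intro: order_trans)
  qed
  moreover have "x \<in> principal_filt x"
    by (auto simp: principal_filt_def intro!: exI[of _ "1::nat"])
  moreover fix a assume "a \<in> filter_gen (*) {x}"
  ultimately show "a \<in> principal_filt x"
    unfolding residuated.in_princ_iff by blast
qed

lemma normal_Filt_iff: "normal_Filt TYPE('a::residuated_lattice) \<longleftrightarrow>
    integral_lattice_monoid.conormal_mod_nil ((*) :: 'a \<Rightarrow> 'a \<Rightarrow> 'a)"
  by (simp add: normal_Filt_def residuated.conormal_iff_normal_filters one_eq_top)

lemma normal_PFilt_iff_conormal: "normal_PFilt TYPE('a::residuated_lattice) \<longleftrightarrow>
    integral_lattice_monoid.conormal_mod_nil ((*) :: 'a \<Rightarrow> 'a \<Rightarrow> 'a)"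
  by (simp add: normal_PFilt_def residuated.conormal_iff_normal_princ one_eq_top
      principal_filt_eq_filter_gen[abs_def])

lemma distributive_nilpotent_iff:
  "distributive.nilpotent z \<longleftrightarrow> (z :: 'a::bounded_distrib_lattice) = bot"
proof
  have "lat_filter inf {z..}"
    by (auto simp: lat_filter_def intro: order_trans)
  moreover assume "distributive.nilpotent z"
  ultimately have "bot \<in> {z..}"
    unfolding distributive.nilpotent_def distributive.in_princ_iff by blast
  then show "z = bot"
    by (simp add: bot_unique)
next
  assume "z = bot"
  then show "distributive.nilpotent z"
    by (simp add: distributive.nilpotent_def distributive.princ_self)
qed

lemma conormal_lattice_iff:
  "conormal_lattice (UNIV :: 'a::bounded_distrib_lattice set) sup inf bot top \<longleftrightarrow>
     integral_lattice_monoid.conormal_mod_nil (inf :: 'a \<Rightarrow> 'a \<Rightarrow> 'a)"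
  by (simp add: conormal_lattice_def distributive.conormal_mod_nil_def distributive_nilpotent_iff)

text \<open>The two sides correspond under \<open>l\<close> word by word: \<open>l\<close> is onto, so quantifiers range over images;
  \<open>l z = bot\<close> says that some power of \<open>z\<close> is \<open>bot\<close>, that is, that \<open>z\<close> is nilpotent; and \<open>l a = top\<close>
  forces \<open>a = 1\<close>, since \<open>1 ^ n = 1\<close>.\<close>

lemma reticulation_conormal_iff:
  fixes l :: "'a::residuated_lattice \<Rightarrow> 'l::bounded_distrib_lattice"
  assumes "is_reticulation l"
  shows "integral_lattice_monoid.conormal_mod_nil ((*) :: 'a \<Rightarrow> 'a \<Rightarrow> 'a) \<longleftrightarrow>
    conormal_lattice (UNIV :: 'l set) sup inf bot top"
proof -
  have surj: "surj l" and mult: "l (a * b) = inf (l a) (l b)" and sup: "l (sup a b) = sup (l a) (l b)"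
    and bot: "l bot = bot" and one: "l 1 = top" and le: "l a \<le> l b \<longleftrightarrow> (\<exists>n\<ge>1. a ^ n \<le> b)" for a b
    using assms by (auto simp: is_reticulation_def)
  have nil: "residuated.nilpotent z \<longleftrightarrow> l z = bot" for z
  proof -
    have "l z = bot \<longleftrightarrow> l z \<le> l bot"
      by (simp add: bot bot_unique)
    also have "\<dots> \<longleftrightarrow> residuated.nilpotent z"
      unfolding le residuated.nilpotent_def
      by (simp add: principal_filt_def flip: principal_filt_eq_filter_gen)
    finally show ?thesis
      by simp
  qed
  have top: "a = top \<longleftrightarrow> l a = top" for a
  proof -
    have "l a = top \<longleftrightarrow> l 1 \<le> l a"
      by (simp add: one top_unique)
    also have "\<dots> \<longleftrightarrow> top \<le> a"
      unfolding le by (auto simp: one_eq_top[symmetric])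
    finally show ?thesis
      by (simp add: top_unique)
  qed
  have all: "(\<forall>x. Q x) \<longleftrightarrow> (\<forall>a. Q (l a))" and ex: "(\<exists>x. Q x) \<longleftrightarrow> (\<exists>a. Q (l a))" for Q
    using surj by (metis surjD)+
  show ?thesis
    unfolding residuated.conormal_mod_nil_def nil top mult sup conormal_lattice_def
    by (simp add: all ex)
qed

theorem proposition6p4:
  fixes l :: "'a::residuated_lattice \<Rightarrow> 'l::bounded_distrib_lattice"
  assumes "is_reticulation l"
  shows "let A = ((*) :: 'a \<Rightarrow> 'a \<Rightarrow> 'a); L = (inf :: 'l \<Rightarrow> 'l \<Rightarrow> 'l) in tfae [
    normal_Filt TYPE('a),
    normal_PFilt TYPE('a),
    conormal_lattice (UNIV :: 'l set) sup inf bot top,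
    (\<forall>P\<in>Spec_filt A. \<exists>!M. M \<in> Max_filt A \<and> P \<subseteq> M),
    (\<forall>P\<in>Spec_filt L. \<exists>!M. M \<in> Max_filt L \<and> P \<subseteq> M),
    Max_filt A retract_of_space spec_top A,
    Max_filt L retract_of_space spec_top L,
    normal_space (spec_top A),
    normal_space (spec_top L),
    (\<forall>M\<in>Max_filt A. closedin (spec_top A) {P \<in> Spec_filt A. P \<subseteq> M}),
    (\<forall>M\<in>Max_filt L. closedin (spec_top L) {P \<in> Spec_filt L. P \<subseteq> M}),
    (\<forall>M\<in>Max_filt A. {N \<in> Max_filt A. \<Inter>{P \<in> Spec_filt A. P \<subseteq> M} \<subseteq> N} = {M}),
    (\<forall>M\<in>Max_filt L. {N \<in> Max_filt L. \<Inter>{P \<in> Spec_filt L. P \<subseteq> M} \<subseteq> N} = {M}),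
    (\<forall>M\<in>Max_filt A. \<forall>N\<in>Max_filt A. M \<noteq> N \<longrightarrow>
       (\<exists>U V. openin (spec_top A) U \<and> openin (spec_top A) V \<and> M \<in> U \<and> N \<in> V \<and> disjnt U V)),
    (\<forall>M\<in>Max_filt L. \<forall>N\<in>Max_filt L. M \<noteq> N \<longrightarrow>
       (\<exists>U V. openin (spec_top L) U \<and> openin (spec_top L) V \<and> M \<in> U \<and> N \<in> V \<and> disjnt U V))]"
proof -
  have A_iff_L: "integral_lattice_monoid.conormal_mod_nil ((*) :: 'a \<Rightarrow> 'a \<Rightarrow> 'a) \<longleftrightarrow>
      integral_lattice_monoid.conormal_mod_nil (inf :: 'l \<Rightarrow> 'l \<Rightarrow> 'l)"
    by (simp only: reticulation_conormal_iff[OF assms] conormal_lattice_iff)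
  show ?thesis
    unfolding Let_def
      normal_Filt_iff normal_PFilt_iff_conormal conormal_lattice_iff
      residuated.conormal_iff_spectral_conditions[symmetric]
      distributive.conormal_iff_spectral_conditions[symmetric]
    using A_iff_L by (simp add: tfae_def)
qed

end
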